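(* Let $X$ be a real Banach space, let $\partial$ be a subdifferential on $X$ satisfying the Separation Principle, and let $f:X\to\,]-\infty,+\infty]$ be proper, lower semicontinuous and prox-bounded with threshold $\lambda_f\ge 0$. Then for every $\lambda>\lambda_f$ and every $\varepsilon\ge 0$, $$(\partial f)^\varepsilon \subset \operatorname{cl}\left(\partial f+\sqrt{\lambda^{-1}\varepsilon}\,B_X \times \sqrt{\lambda\varepsilon}\,B_{X^*}\right).$$ Equivalently: for all $\lambda>\lambda_f$ and $\varepsilon\ge 0$, for every $(x,x^* )\in(\partial f)^\varepsilon$ there exists a sequence $((x_n,x_n^* ))_n\subset\partial f$ such that $$\lim_n\|x-x_n\|\le\sqrt{\lambda^{-1}\varepsilon}\quad\text{and}\quad \lim_n\|x^*-x_n^*\|\le\sqrt{\lambda\varepsilon}$$ (both limits existing).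
   Context: $X$ is a real Banach space with closed unit ball $B_X$, $X^*$ its topological dual with closed unit ball $B_{X^*}$, and $\langle\cdot,\cdot\rangle$ the duality pairing. A function $f:X\to\,]-\infty,+\infty]$ is proper if $\operatorname{dom} f:=\{x\in X: f(x)<\infty\}$ is nonempty; "function on $X$" below means a proper lower semicontinuous function $X\to\,]-\infty,+\infty]$. Set-valued operators $T:X\rightrightarrows X^*$ are identified with their graphs $T\subset X\times X^*$, so $x^*\in T(x)$ means $(x,x^* )\in T$. Closures are taken in the norm topology (norm$\times$norm topology in $X\times X^*$), and for $a,b\ge 0$, $T+aB_X\times bB_{X^*}$ denotes the Minkowski sum in $X\times X^*$ of the graph $T$ and the set $(aB_X)\times(bB_{X^*})$. For $\varepsilon\ge 0$, $$T^\varepsilon:=\{(x,x^* )\in X\times X^*: \langle y^*-x^*,y-x\rangle\ge-\varepsilon\ \text{ for all } (y,y^* )\in T\}.$$ A subdifferential on $X$ is a map $\partial$ that associates to each function $f$ on $X$ a set-valued operator $\partial f:X\rightrightarrows X^*$, such that when $f$ is convex, $\partial f$ is the convex subdifferential $\partial f(x)=\{x^*\in X^*:\langle x^*,y-x\rangle+f(x)\le f(y)\ \forall y\in X\}$. It satisfies the Separation Principle if: for any lower semicontinuous functions $f,\varphi$ on $X$ with $\varphi$ convex and Lipschitz near $\bar x\in\operatorname{dom} f\cap\operatorname{dom}\varphi$, if $f+\varphi$ admits a local minimum at $\bar x$, then $0\in\partial f(\bar x)+\partial\varphi(\bar x)$. Let $j(x)=\tfrac12\|x\|^2$. A function $f$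 on $X$ is prox-bounded if there exists $\lambda>0$ such that $f+\lambda j$ is bounded from below on $X$; its threshold of prox-boundedness is $\lambda_f:=\inf\{\lambda>0:\inf_X(f+\lambda j)>-\infty\}$. *)

theory Defs
  imports "HOL-Analysis.Analysis" "HOL-Library.Set_Algebras"
begin

text \<open>
  The dual of \<open>X\<close> is the type of bounded linear functionals \<open>X \<Rightarrow>\<^sub>L real\<close> with the operator norm.
  Set-valued operators from \<open>X\<close> to its dual are identified with their graphs.
\<close>

type_synonym 'a dual = "'a \<Rightarrow>\<^sub>L real"
type_synonym 'a operator = "('a \<times> 'a dual) set"

definition dom :: "('a \<Rightarrow> ereal) \<Rightarrow> 'a set" where
  "dom f = {x. f x < \<infinity>}"

definition proper :: "('a \<Rightarrow> ereal) \<Rightarrow> bool" where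
  "proper f \<longleftrightarrow> (\<forall>x. f x \<noteq> -\<infinity>) \<and> dom f \<noteq> {}"

definition lower_semicontinuous :: "('a::topological_space \<Rightarrow> ereal) \<Rightarrow> bool" where
  "lower_semicontinuous f \<longleftrightarrow> (\<forall>x. f x \<le> Liminf (at x) f)"

definition proper_lsc :: "('a::topological_space \<Rightarrow> ereal) \<Rightarrow> bool" where
  "proper_lsc f \<longleftrightarrow> proper f \<and> lower_semicontinuous f"

text \<open>
  The library predicate \<open>convex_on\<close> covers real-valued functions only.  The next definition is
  used only for functions that do not take the value \<open>-\<infinity>\<close>, so the right-hand side is never
  of the form \<open>\<infinity> - \<infinity>\<close>; since \<open>0 < t < 1\<close>, it is not of the form \<open>0 * \<infinity>\<close> either.
\<close>

definition convex_fun :: "('a::real_vector \<Rightarrow> ereal) \<Rightarrow> bool" where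
  "convex_fun f \<longleftrightarrow>
     (\<forall>x y t. 0 < t \<and> t < 1 \<longrightarrow>
        f ((1 - t) *\<^sub>R x + t *\<^sub>R y) \<le> ereal (1 - t) * f x + ereal t * f y)"

definition lipschitz_near :: "('a::metric_space \<Rightarrow> ereal) \<Rightarrow> 'a \<Rightarrow> bool" where
  "lipschitz_near f x \<longleftrightarrow>
     (\<exists>U L. open U \<and> x \<in> U \<and> (\<forall>y\<in>U. \<bar>f y\<bar> \<noteq> \<infinity>) \<and>
            L-lipschitz_on U (\<lambda>y. real_of_ereal (f y)))"

definition local_min_at :: "('a::topological_space \<Rightarrow> ereal) \<Rightarrow> 'a \<Rightarrow> bool" where
  "local_min_at f x \<longleftrightarrow> (\<forall>\<^sub>F y in nhds x. f x \<le> f y)"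

definition convex_subdifferential ::
    "('a::real_normed_vector \<Rightarrow> ereal) \<Rightarrow> 'a operator" where
  "convex_subdifferential f =
     {(x, xs). \<forall>y. ereal (blinfun_apply xs (y - x)) + f x \<le> f y}"

text \<open>
  A subdifferential is only meaningful on proper lower semicontinuous functions; its values on
  all other functions are irrelevant and left unconstrained.
\<close>

definition subdifferential ::
    "(('a::real_normed_vector \<Rightarrow> ereal) \<Rightarrow> 'a operator) \<Rightarrow> bool" where
  "subdifferential D \<longleftrightarrow>
     (\<forall>f. proper_lsc f \<and> convex_fun f \<longrightarrow> D f = convex_subdifferential f)"

text \<open>
  For a graph \<open>T\<close>, the image \<open>T `` {x}\<close> is the value of the operator at \<open>x\<close>; the sum of the
  two values below is the Minkowski sum.
\<close>

definition separation_principle ::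
    "(('a::real_normed_vector \<Rightarrow> ereal) \<Rightarrow> 'a operator) \<Rightarrow> bool" where
  "separation_principle D \<longleftrightarrow>
     (\<forall>f \<phi> x. proper_lsc f \<and> proper_lsc \<phi> \<and> x \<in> dom f \<inter> dom \<phi> \<and>
        convex_fun \<phi> \<and> lipschitz_near \<phi> x \<and> local_min_at (\<lambda>y. f y + \<phi> y) x \<longrightarrow>
        0 \<in> D f `` {x} + D \<phi> `` {x})"

definition enlargement :: "'a::real_normed_vector operator \<Rightarrow> real \<Rightarrow> 'a operator" where
  "enlargement T \<epsilon> =
     {(x, xs). \<forall>(y, ys)\<in>T. blinfun_apply (ys - xs) (y - x) \<ge> - \<epsilon>}"

definition j :: "'a::real_normed_vector \<Rightarrow> real" where
  "j x = (norm x)\<^sup>2 / 2"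

definition prox_bounding :: "('a::real_normed_vector \<Rightarrow> ereal) \<Rightarrow> real set" where
  "prox_bounding f = {l. l > 0 \<and> (INF x. f x + ereal (l * j x)) > -\<infinity>}"

definition prox_bounded :: "('a::real_normed_vector \<Rightarrow> ereal) \<Rightarrow> bool" where
  "prox_bounded f \<longleftrightarrow> prox_bounding f \<noteq> {}"

text \<open>
  The infimum in \<open>real\<close> is the intended one for prox-bounded \<open>f\<close>, where the set is nonempty
  (it is always bounded below by 0).
\<close>

definition prox_threshold :: "('a::real_normed_vector \<Rightarrow> ereal) \<Rightarrow> real" where
  "prox_threshold f = Inf (prox_bounding f)"

abbreviation unit_ball :: "'a::real_normed_vector set" where
  "unit_ball \<equiv> cball 0 1"

end

theory Submission
  imports Defs
begin

text \<open>
  Let \<open>(x, xs)\<close> belong to the \<open>\<epsilon>\<close>-enlargement of \<open>D f\<close>. The idea is to add to \<open>f\<close> the tilt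
  \<open>- xs\<close>, which moves the target slope \<open>xs\<close> to \<open>0\<close>, and the quadratic penalty
  \<open>l / 2 * \<parallel>y - x\<parallel>\<^sup>2\<close>, which keeps points close to \<open>x\<close>. Since \<open>l\<close> exceeds the threshold
  of prox-boundedness, the quadratic term dominates both the possible decay of \<open>f\<close> and the linear
  tilt, so the sum is bounded below (\<open>bounded_below_tilted_regularization\<close>). A minimizer need not
  exist, but Ekeland's variational principle (\<open>ekeland_minimum\<close>) gives, for each \<open>\<delta> > 0\<close>, a
  point \<open>y\<close> that becomes a minimizer once the convex term \<open>\<delta> * \<parallel>z - y\<parallel>\<close> is added. The
  perturbation is convex and locally Lipschitz, so the Separation Principle
  (\<open>separation_real_perturbation\<close>) produces \<open>ys \<in> D f y\<close> for which \<open>s = xs - ys\<close> is a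
  convex subgradient at \<open>y\<close> of \<open>z \<mapsto> l / 2 * \<parallel>z - x\<parallel>\<^sup>2 + \<delta> * \<parallel>z - y\<parallel>\<close>.

  Put \<open>r = \<parallel>y - x\<parallel>\<close>. Testing this subgradient in all directions, and in the direction of \<open>x\<close>,
  gives (\<open>penalty_subgradient_estimates\<close>)
  \<open>\<parallel>s\<parallel> \<le> l * r + \<delta>\<close> and \<open>l * r\<^sup>2 - \<delta> * r \<le> s (y - x)\<close>.
  Thus \<open>s\<close> behaves, up to \<open>\<delta>\<close>, like an element of \<open>l\<close> times the duality mapping at
  \<open>y - x\<close>. On the other hand, the inequality that defines the enlargement, read at the point
  \<open>(y, ys)\<close> of \<open>D f\<close>, says that \<open>s (y - x) \<le> \<epsilon>\<close>. Hence \<open>l * r\<^sup>2 - \<delta> * r \<le> \<epsilon>\<close>, and as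
  \<open>\<delta>\<close> tends to \<open>0\<close> the bounds on \<open>r\<close> and \<open>\<parallel>s\<parallel>\<close> approach \<open>sqrt (\<epsilon> / l)\<close> and
  \<open>l * sqrt (\<epsilon> / l) = sqrt (l * \<epsilon>)\<close>. This is \<open>approximate_enlargement\<close>.

  Both forms of the conclusion follow from this approximation: for the closure, an overshoot beyond
  the two balls is removed by radial projection; for the sequence, a subsequence makes the two
  bounded sequences of distances converge.
\<close>

section \<open>Lower semicontinuity\<close>

lemma lower_semicontinuous_iff_nhds:
  "lower_semicontinuous f \<longleftrightarrow> (\<forall>x c. c < f x \<longrightarrow> (\<forall>\<^sub>F y in nhds x. c < f y))"
  unfolding lower_semicontinuous_def le_Liminf_iff
  by (auto simp: eventually_nhds_conv_at)

lemma lower_semicontinuous_add_continuous: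
  fixes f :: "'a::topological_space \<Rightarrow> ereal" and h :: "'a \<Rightarrow> real"
  assumes f: "lower_semicontinuous f" and h: "continuous_on UNIV h"
  shows "lower_semicontinuous (\<lambda>x. f x + ereal (h x))"
  unfolding lower_semicontinuous_iff_nhds
proof (intro allI impI)
  fix x c assume c: "c < f x + ereal (h x)"
  then obtain e where e: "c < ereal e" "ereal e < f x + ereal (h x)"
    using ereal_dense2 by blast
  then have "ereal (e - h x) < f x"
    by (cases "f x") auto
  \<comment> \<open>Split the level \<open>e\<close> into a level \<open>d\<close> for \<open>f\<close> and a level \<open>e - d\<close> for \<open>h\<close>,
    each strictly below the corresponding value at \<open>x\<close>.\<close>
  then obtain d where d: "e - h x < d" "ereal d < f x"
    by (metis ereal_dense2 ereal_less(2) less_ereal.simps(1))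
  have "\<forall>\<^sub>F y in nhds x. ereal d < f y"
    using f d(2) lower_semicontinuous_iff_nhds by blast
  moreover have "\<forall>\<^sub>F y in nhds x. e - d < h y"
  proof -
    have "(h \<longlongrightarrow> h x) (nhds x)"
      using h by (simp add: continuous_on_def tendsto_nhds_iff)
    then show ?thesis
      using d(1) by (intro order_tendstoD(1)) auto
  qed
  ultimately show "\<forall>\<^sub>F y in nhds x. c < f y + ereal (h y)"
  proof eventually_elim
    case (elim y)
    then have "ereal e < f y + ereal (h y)"
      by (cases "f y") auto
    with e(1) show ?case by (rule less_trans)
  qed
qed

lemma closed_below_continuous:
  fixes f :: "'a::topological_space \<Rightarrow> ereal" and h :: "'a \<Rightarrow> real"
  assumes f: "lower_semicontinuous f" and h: "continuous_on UNIV h"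
  shows "closed {x. f x \<le> ereal (h x)}"
proof -
  have lsc: "lower_semicontinuous (\<lambda>x. f x + ereal (- h x))"
    by (intro lower_semicontinuous_add_continuous f continuous_intros h)
  have eq: "- {x. f x \<le> ereal (h x)} = {x. 0 < f x + ereal (- h x)}" (is "_ = ?U")
  proof (rule set_eqI)
    fix x show "x \<in> - {x. f x \<le> ereal (h x)} \<longleftrightarrow> x \<in> ?U"
      by (cases "f x") auto
  qed
  have "open ?U"
  proof (subst open_subopen, rule ballI)
    fix x assume "x \<in> ?U"
    then have "0 < f x + ereal (- h x)"
      by (rule CollectD)
    then have "\<forall>\<^sub>F y in nhds x. 0 < f y + ereal (- h y)"
      using lsc unfolding lower_semicontinuous_iff_nhds by blast
    then show "\<exists>T. open T \<and> x \<in> T \<and> T \<subseteq> ?U"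
      unfolding eventually_nhds by blast
  qed
  then show ?thesis
    by (simp add: closed_def eq)
qed

section \<open>Ekeland's variational principle\<close>

text \<open>
  The relation \<open>z \<in> S y\<close>, meaning \<open>g z + \<delta> * dist z y \<le> g y\<close>, is a partial order on the domain
  of \<open>g\<close>, and the point sought is a minimal element for it. Each \<open>S y\<close> is closed by
  lower semicontinuity. Going down along
  points \<open>u n\<close> whose values are nearly minimal in the preceding set forces the diameters of the
  nested sets \<open>S (u n)\<close> to \<open>0\<close>, because the drop of \<open>g\<close> within a set controls the distances;
  completeness then yields a common point, and it has nothing but itself below it.
\<close>

proposition ekeland_minimum:
  fixes g :: "'a::complete_space \<Rightarrow> ereal"
  assumes g: "proper_lsc g" and bound: "\<And>x. ereal c \<le> g x" and "0 < \<delta>"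
  obtains y where "y \<in> dom g" "\<And>z. g y \<le> g z + ereal (\<delta> * dist z y)"
proof -
  define G where "G x = real_of_ereal (g x)" for x
  have g_eq: "g x = ereal (G x)" if "x \<in> dom g" for x
    using bound[of x] that unfolding G_def dom_def by (cases "g x") auto
  have G_bound: "c \<le> G x" if "x \<in> dom g" for x
    using bound[of x] g_eq[OF that] by simp
  define S where "S y = {z. g z \<le> ereal (G y - \<delta> * dist z y)}" for y
  have S_dom: "z \<in> dom g" if "z \<in> S y" for y z
    using that unfolding S_def dom_def by auto
  have S_iff: "z \<in> S y \<longleftrightarrow> z \<in> dom g \<and> G z + \<delta> * dist z y \<le> G y" for y z
    using S_dom[of z y] g_eq[of z] unfolding S_def by (auto simp: algebra_simps)
  have S_refl: "y \<in> S y" if "y \<in> dom g" for y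
    using that by (simp add: S_iff)
  have S_trans: "S z \<subseteq> S y" if "z \<in> S y" for y z
  proof
    fix w assume "w \<in> S z"
    moreover have "\<delta> * dist w y \<le> \<delta> * dist w z + \<delta> * dist z y"
      using \<open>0 < \<delta>\<close> by (simp flip: distrib_left add: dist_triangle)
    ultimately show "w \<in> S y"
      using that by (auto simp: S_iff)
  qed
  have S_closed: "closed (S y)" for y
    unfolding S_def using g
    by (intro closed_below_continuous continuous_intros) (simp add: proper_lsc_def)

  have "\<exists>u. \<forall>n. u n \<in> dom g \<and>
          (u (Suc n) \<in> S (u n) \<and> (\<forall>z\<in>S (u n). G (u (Suc n)) \<le> G z + inverse (Suc n)))"
  proof (rule dependent_nat_choice)
    show "\<exists>x. x \<in> dom g"
      using g by (auto simp: proper_lsc_def proper_def)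
    fix x and n :: nat assume x: "x \<in> dom g"
    have bdd: "bdd_below (G ` S x)"
      using G_bound S_dom by (intro bdd_belowI[of _ c]) auto
    have "\<exists>y\<in>S x. G y < Inf (G ` S x) + inverse (Suc n)"
      using cInf_lessD[of "G ` S x" "Inf (G ` S x) + inverse (Suc n)"] S_refl[OF x] by force
    then obtain y where "y \<in> S x" "G y < Inf (G ` S x) + inverse (Suc n)"
      by blast
    moreover from this have "G y \<le> G z + inverse (Suc n)" if "z \<in> S x" for z
      using cInf_lower[OF _ bdd, of "G z"] that by fastforce
    ultimately show "\<exists>y. y \<in> dom g \<and> (y \<in> S x \<and> (\<forall>z\<in>S x. G y \<le> G z + inverse (Suc n)))"
      using S_dom by blast
  qed
  then obtain u where u: "\<And>n. u n \<in> dom g" "\<And>n. u (Suc n) \<in> S (u n)"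
      "\<And>n z. z \<in> S (u n) \<Longrightarrow> G (u (Suc n)) \<le> G z + inverse (Suc n)"
    by blast
  have decreasing: "S (u n) \<subseteq> S (u m)" if "m \<le> n" for m n
    using lift_Suc_antimono_le[of "\<lambda>n. S (u n)", OF S_trans[OF u(2)] that] .
  \<comment> \<open>A point of \<open>S (u (Suc n))\<close> also competed in the choice of \<open>u (Suc n)\<close>, so its value can be
    smaller by at most \<open>inverse (Suc n)\<close>.\<close>
  have radius: "\<delta> * dist z (u (Suc n)) \<le> inverse (Suc n)" if "z \<in> S (u (Suc n))" for z n
  proof -
    have "z \<in> S (u n)"
      using that S_trans[OF u(2)[of n]] by blast
    from u(3)[OF this] that show ?thesis
      by (simp add: S_iff[of z "u (Suc n)"])
  qed
  have small: "\<exists>n. \<forall>x\<in>S (u n). \<forall>y\<in>S (u n). dist x y < e" if "0 < e" for e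
  proof -
    obtain n where n: "inverse (Suc n) < \<delta> * e / 2"
      using reals_Archimedean[of "\<delta> * e / 2"] \<open>0 < \<delta>\<close> \<open>0 < e\<close> by auto
    have half: "dist z (u (Suc n)) < e / 2" if "z \<in> S (u (Suc n))" for z
    proof -
      have "\<delta> * dist z (u (Suc n)) < \<delta> * (e / 2)"
        using radius[OF that] n by simp
      then show ?thesis
        using \<open>0 < \<delta>\<close> mult_less_cancel_left_pos by blast
    qed
    have "dist x y < e" if "x \<in> S (u (Suc n))" "y \<in> S (u (Suc n))" for x y
      using half[OF that(1)] half[OF that(2)] by (rule dist_triangle_half_l)
    then show ?thesis by blast
  qed
  obtain a where a: "\<And>n. a \<in> S (u n)"
    using decreasing_closed_nest[of "\<lambda>n. S (u n)"] S_closed S_refl u(1) decreasing small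
    by (metis empty_iff)
  have only_a: "z = a" if "z \<in> S a" for z
  proof (rule ccontr)
    assume "z \<noteq> a"
    then obtain n where "\<forall>x\<in>S (u n). \<forall>y\<in>S (u n). dist x y < dist z a"
      using small[of "dist z a"] by auto
    moreover have "z \<in> S (u n)"
      using that S_trans[OF a[of n]] by auto
    ultimately show False
      using a[of n] by blast
  qed
  show thesis
  proof
    show a_dom: "a \<in> dom g"
      using a S_dom by blast
    fix z
    show "g a \<le> g z + ereal (\<delta> * dist z a)"
    proof (cases "z \<in> S a")
      case True
      then have "z = a" by (rule only_a)
      then show ?thesis by simp
    next
      case False
      then have "\<not> g z \<le> ereal (G a - \<delta> * dist z a)"
        by (simp add: S_def)
      then show ?thesis
        by (cases "g z") (auto simp: g_eq[OF a_dom])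
    qed
  qed
qed

section \<open>The Separation Principle for real-valued convex perturbations\<close>

text \<open>
  The Separation Principle splits \<open>0 = ys + t\<close>, and \<open>t\<close> is a convex subgradient of \<open>\<psi>\<close>;
  the conclusion states this for \<open>t = - ys\<close>.
\<close>

lemma separation_real_perturbation:
  fixes D :: "('a::real_normed_vector \<Rightarrow> ereal) \<Rightarrow> 'a operator" and \<psi> :: "'a \<Rightarrow> real"
  assumes D: "subdifferential D" "separation_principle D"
    and f: "proper_lsc f" "y \<in> dom f"
    and convex: "convex_on UNIV \<psi>" and cont: "continuous_on UNIV \<psi>"
    and lipschitz: "open U" "y \<in> U" "L-lipschitz_on U \<psi>"
    and minimum: "\<And>z. f y + ereal (\<psi> y) \<le> f z + ereal (\<psi> z)"
  obtains ys where "(y, ys) \<in> D f" "\<And>z. \<psi> y - blinfun_apply ys (z - y) \<le> \<psi> z"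
proof -
  let ?\<phi> = "\<lambda>z. ereal (\<psi> z)"
  have "lower_semicontinuous ?\<phi>"
    using lower_semicontinuous_add_continuous[of "\<lambda>_. 0" \<psi>] cont
    by (simp add: lower_semicontinuous_iff_nhds)
  then have plsc: "proper_lsc ?\<phi>"
    by (auto simp: proper_lsc_def proper_def dom_def)
  have conv: "convex_fun ?\<phi>"
    unfolding convex_fun_def using convex_onD[OF convex] by simp
  have "lipschitz_near ?\<phi> y"
    unfolding lipschitz_near_def using lipschitz by (intro exI[of _ U] exI[of _ L]) auto
  moreover have "local_min_at (\<lambda>z. f z + ?\<phi> z) y"
    unfolding local_min_at_def by (intro always_eventually allI minimum)
  moreover have "y \<in> dom f \<inter> dom ?\<phi>"
    using f(2) by (simp add: dom_def)
  ultimately have "0 \<in> D f `` {y} + D ?\<phi> `` {y}"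
    using D(2) f(1) plsc conv unfolding separation_principle_def by blast
  then obtain ys t where "(y, ys) \<in> D f" and t: "(y, t) \<in> D ?\<phi>" "0 = ys + t"
    by (auto elim: set_plus_elim)
  moreover have "\<psi> y - blinfun_apply ys (z - y) \<le> \<psi> z" for z
  proof -
    have "(y, t) \<in> convex_subdifferential ?\<phi>"
      using t(1) D(1) plsc conv unfolding subdifferential_def by auto
    then have "blinfun_apply t (z - y) + \<psi> y \<le> \<psi> z"
      by (simp add: convex_subdifferential_def)
    moreover have "t = - ys"
      using t(2) by (simp add: eq_neg_iff_add_eq_0 add.commute)
    ultimately show ?thesis
      by (simp add: blinfun.minus_left)
  qed
  ultimately show thesis
    using that by blast
qed

section \<open>The quadratic penalty\<close>

text \<open>
  Convexity of the norm followed by convexity and monotonicity of the square on nonnegative reals.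
\<close>

lemma convex_on_norm_diff_power2: "convex_on UNIV (\<lambda>y::'a::real_normed_vector. (norm (y - x))\<^sup>2)"
proof (rule convex_onI)
  fix t :: real and a b :: 'a
  assume t: "0 < t" "t < 1"
  define p q where "p = norm (a - x)" and "q = norm (b - x)"
  have "(1 - t) *\<^sub>R a + t *\<^sub>R b - x = (1 - t) *\<^sub>R (a - x) + t *\<^sub>R (b - x)"
    by (simp add: algebra_simps)
  then have "norm ((1 - t) *\<^sub>R a + t *\<^sub>R b - x) \<le> (1 - t) * p + t * q"
    using norm_triangle_ineq[of "(1 - t) *\<^sub>R (a - x)" "t *\<^sub>R (b - x)"] t
    by (simp add: p_def q_def)
  then have "(norm ((1 - t) *\<^sub>R a + t *\<^sub>R b - x))\<^sup>2 \<le> ((1 - t) * p + t * q)\<^sup>2"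
    by (rule power_mono) simp
  also have "\<dots> = (1 - t) * p\<^sup>2 + t * q\<^sup>2 - t * (1 - t) * (p - q)\<^sup>2"
    by (simp add: power2_eq_square algebra_simps)
  also have "\<dots> \<le> (1 - t) * p\<^sup>2 + t * q\<^sup>2"
    using t by simp
  finally show "(norm ((1 - t) *\<^sub>R a + t *\<^sub>R b - x))\<^sup>2
      \<le> (1 - t) * (norm (a - x))\<^sup>2 + t * (norm (b - x))\<^sup>2"
    by (simp add: p_def q_def)
qed auto

lemma lipschitz_on_ball_norm_diff_power2:
  "(2 * (norm (y - x) + 1))-lipschitz_on (ball y 1) (\<lambda>z::'a::real_normed_vector. (norm (z - x))\<^sup>2)"
proof (rule lipschitz_onI)
  fix a b :: 'a assume ab: "a \<in> ball y 1" "b \<in> ball y 1"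
  have *: "norm (c - x) \<le> norm (y - x) + 1" if "c \<in> ball y 1" for c
    using norm_triangle_ineq[of "c - y" "y - x"] that by (simp add: dist_norm norm_minus_commute)
  have "\<bar>(norm (a - x))\<^sup>2 - (norm (b - x))\<^sup>2\<bar>
      = \<bar>norm (a - x) - norm (b - x)\<bar> * (norm (a - x) + norm (b - x))"
    by (simp add: power2_eq_square square_diff_square_factored abs_mult)
  also have "\<dots> \<le> norm (a - b) * (2 * (norm (y - x) + 1))"
    using *[OF ab(1)] *[OF ab(2)] norm_triangle_ineq3[of "a - x" "b - x"]
    by (intro mult_mono) auto
  finally show "dist ((norm (a - x))\<^sup>2) ((norm (b - x))\<^sup>2) \<le> 2 * (norm (y - x) + 1) * dist a b"
    by (simp add: dist_norm mult.commute)
qed simp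

text \<open>
  Used with \<open>t\<close> as the step length: the quadratic part of an increment disappears after dividing
  by \<open>t\<close> and letting it tend to \<open>0\<close>.
\<close>

lemma one_sided_derivative_bound:
  fixes a b c :: real
  assumes "\<And>t. 0 < t \<Longrightarrow> t < 1 \<Longrightarrow> t * a \<le> t * b + t\<^sup>2 * c"
  shows "a \<le> b"
proof (rule tendsto_lowerbound[of _ _ "at_right 0"])
  show "((\<lambda>t. b + t * c) \<longlongrightarrow> b) (at_right 0)"
    by (auto intro!: tendsto_eq_intros)
  show "\<forall>\<^sub>F t in at_right 0. a \<le> b + t * c"
  proof (rule eventually_at_rightI[of 0 1])
    fix t :: real assume "t \<in> {0<..<1}"
    then have "t * a \<le> t * (b + t * c)" "0 < t"
      using assms[of t] by (auto simp: power2_eq_square algebra_simps)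
    then show "a \<le> b + t * c" by simp
  qed simp
qed simp

text \<open>
  The one-sided derivative at \<open>y\<close> of \<open>z \<mapsto> l / 2 * \<parallel>z - x\<parallel>\<^sup>2 + \<delta> * \<parallel>z - y\<parallel>\<close> is at most \<open>(l * \<parallel>y - x\<parallel> + \<delta>) * \<parallel>h\<parallel>\<close> in the
  direction \<open>h\<close>, by the triangle inequality; this bounds the norm of \<open>s\<close>. In the direction
  \<open>x - y\<close> the norm \<open>\<parallel>z - x\<parallel>\<close> decreases linearly, so there the derivative is exactly
  \<open>- l * \<parallel>y - x\<parallel>\<^sup>2 + \<delta> * \<parallel>y - x\<parallel>\<close>; this bounds \<open>s (y - x)\<close> from below.
\<close>

lemma penalty_subgradient_estimates:
  fixes s :: "'a::real_normed_vector dual" and x y :: 'a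
  assumes "0 \<le> l" "0 \<le> \<delta>"
    and s: "\<And>z. l / 2 * (norm (y - x))\<^sup>2 + blinfun_apply s (z - y)
                 \<le> l / 2 * (norm (z - x))\<^sup>2 + \<delta> * norm (z - y)"
  shows "norm s \<le> l * norm (y - x) + \<delta>"
    and "l * (norm (y - x))\<^sup>2 - \<delta> * norm (y - x) \<le> blinfun_apply s (y - x)"
proof -
  define r where "r = norm (y - x)"
  have "0 \<le> r" by (simp add: r_def)
  have upper: "blinfun_apply s h \<le> (l * r + \<delta>) * norm h" for h
  proof (rule one_sided_derivative_bound)
    fix t :: real assume t: "0 < t" "t < 1"
    have "norm (y + t *\<^sub>R h - x) \<le> r + t * norm h"
      using norm_triangle_ineq[of "y - x" "t *\<^sub>R h"] t by (simp add: r_def algebra_simps)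
    then have "(norm (y + t *\<^sub>R h - x))\<^sup>2 \<le> (r + t * norm h)\<^sup>2"
      by (rule power_mono) simp
    then have "l / 2 * (norm (y + t *\<^sub>R h - x))\<^sup>2 \<le> l / 2 * (r + t * norm h)\<^sup>2"
      using \<open>0 \<le> l\<close> by (intro mult_left_mono) auto
    with s[of "y + t *\<^sub>R h"] t
    have "l / 2 * r\<^sup>2 + t * blinfun_apply s h \<le> l / 2 * (r + t * norm h)\<^sup>2 + \<delta> * (t * norm h)"
      by (simp add: r_def blinfun.scaleR_right)
    then show "t * blinfun_apply s h \<le> t * ((l * r + \<delta>) * norm h) + t\<^sup>2 * (l / 2 * (norm h)\<^sup>2)"
      by (simp add: power2_eq_square algebra_simps)
  qed
  show "norm s \<le> l * norm (y - x) + \<delta>"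
  proof (rule norm_blinfun_bound)
    fix h
    have "\<bar>blinfun_apply s h\<bar> \<le> (l * r + \<delta>) * norm h"
      using upper[of h] upper[of "- h"] by (simp add: abs_le_iff blinfun.minus_right)
    then show "norm (blinfun_apply s h) \<le> (l * norm (y - x) + \<delta>) * norm h"
      by (simp add: r_def)
  qed (use assms \<open>0 \<le> r\<close> in \<open>simp add: r_def\<close>)
  have "l * r\<^sup>2 - \<delta> * r \<le> blinfun_apply s (y - x)"
  proof (rule one_sided_derivative_bound)
    fix t :: real assume t: "0 < t" "t < 1"
    define z where "z = y - t *\<^sub>R (y - x)"
    have "z - x = (1 - t) *\<^sub>R (y - x)" "z - y = - (t *\<^sub>R (y - x))"
      by (simp_all add: z_def algebra_simps)
    then have "norm (z - x) = (1 - t) * r" "norm (z - y) = t * r"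
        "blinfun_apply s (z - y) = - (t * blinfun_apply s (y - x))"
      using t by (simp_all add: r_def blinfun.minus_right blinfun.scaleR_right)
    with s[of z] have "l / 2 * r\<^sup>2 - t * blinfun_apply s (y - x)
        \<le> l / 2 * ((1 - t) * r)\<^sup>2 + \<delta> * (t * r)"
      by (simp add: r_def)
    then show "t * (l * r\<^sup>2 - \<delta> * r) \<le> t * blinfun_apply s (y - x) + t\<^sup>2 * (l / 2 * r\<^sup>2)"
      by (simp add: power2_eq_square algebra_simps)
  qed
  then show "l * (norm (y - x))\<^sup>2 - \<delta> * norm (y - x) \<le> blinfun_apply s (y - x)"
    by (simp add: r_def)
qed

section \<open>Approximating points of the enlargement\<close>

lemma prox_threshold_nonneg:
  assumes "prox_bounded f"
  shows "0 \<le> prox_threshold f"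
  using assms unfolding prox_threshold_def prox_bounded_def
  by (intro cInf_greatest) (auto simp: prox_bounding_def)

text \<open>
  Some \<open>\<mu> < l\<close> already makes \<open>f + \<mu> * j\<close> bounded below. The remaining part of the penalty is, in
  terms of \<open>\<parallel>y\<parallel>\<close>, at least a quadratic polynomial with positive leading coefficient
  \<open>\<kappa> = (l - \<mu>) / 2\<close>, which absorbs the linear terms from the tilt and from the centre \<open>x\<close>.
\<close>

lemma bounded_below_tilted_regularization:
  fixes f :: "'a::real_normed_vector \<Rightarrow> ereal" and xs :: "'a dual"
  assumes f: "prox_bounded f" and l: "prox_threshold f < l"
  obtains c where "\<And>y. ereal c \<le> f y + ereal (l / 2 * (norm (y - x))\<^sup>2 - blinfun_apply xs y)"
proof -
  obtain \<mu> where \<mu>: "\<mu> \<in> prox_bounding f" "\<mu> < l"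
    using cInf_lessD f l unfolding prox_bounded_def prox_threshold_def by blast
  then have "- \<infinity> < (INF y. f y + ereal (\<mu> * j y))"
    by (simp add: prox_bounding_def)
  then obtain b where "ereal b < (INF y. f y + ereal (\<mu> * j y))"
    using ereal_dense2 by blast
  then have b: "ereal b \<le> f y + ereal (\<mu> * j y)" for y
    by (meson INF_lower UNIV_I less_imp_le order_trans)
  define \<kappa> where "\<kappa> = (l - \<mu>) / 2"
  define m where "m = l * norm x + norm xs"
  have "0 < \<kappa>" "0 < l"
    using \<mu> by (auto simp: \<kappa>_def prox_bounding_def)
  have "- (m\<^sup>2 / (4 * \<kappa>)) \<le> l / 2 * (norm (y - x))\<^sup>2 - blinfun_apply xs y - \<mu> * j y" for y
  proof -
    have "(norm y - norm x)\<^sup>2 \<le> (norm (y - x))\<^sup>2"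
      using norm_triangle_ineq3[of y x] by (simp add: abs_le_square_iff[symmetric])
    then have "l / 2 * (norm y - norm x)\<^sup>2 \<le> l / 2 * (norm (y - x))\<^sup>2"
      using \<open>0 < l\<close> by (intro mult_left_mono) auto
    moreover have "blinfun_apply xs y \<le> norm xs * norm y"
      using norm_blinfun[of xs y] by simp
    moreover have "l / 2 * (norm y - norm x)\<^sup>2 - norm xs * norm y - \<mu> * j y
        = \<kappa> * (norm y)\<^sup>2 - m * norm y + l / 2 * (norm x)\<^sup>2"
      by (simp add: \<kappa>_def m_def j_def power2_eq_square field_simps)
    moreover have "\<kappa> * (norm y)\<^sup>2 - m * norm y = \<kappa> * (norm y - m / (2 * \<kappa>))\<^sup>2 - m\<^sup>2 / (4 * \<kappa>)"
      using \<open>0 < \<kappa>\<close> by (simp add: power2_eq_square field_simps)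
    moreover have "0 \<le> \<kappa> * (norm y - m / (2 * \<kappa>))\<^sup>2" "0 \<le> l / 2 * (norm x)\<^sup>2"
      using \<open>0 < \<kappa>\<close> \<open>0 < l\<close> by auto
    ultimately show ?thesis by linarith
  qed
  then have "ereal (b - m\<^sup>2 / (4 * \<kappa>)) \<le> f y + ereal (l / 2 * (norm (y - x))\<^sup>2 - blinfun_apply xs y)" for y
    using b[of y]
    by (cases "f y") (simp_all, smt (verit))
  then show thesis
    using that by blast
qed

text \<open>
  With \<open>R = sqrt (\<epsilon> / l)\<close>, a number \<open>r > R + \<delta> / l\<close> would satisfy
  \<open>l * r\<^sup>2 - \<delta> * r = l * (r - \<delta> / l) * r > l * R * r \<ge> l * R\<^sup>2 = \<epsilon>\<close>.
\<close>

lemma sqrt_bound_of_quadratic: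
  fixes r l \<delta> \<epsilon> :: real
  assumes "0 < l" "0 \<le> \<delta>" "0 \<le> \<epsilon>" "l * r\<^sup>2 - \<delta> * r \<le> \<epsilon>"
  shows "r \<le> sqrt (inverse l * \<epsilon>) + \<delta> / l"
proof (rule ccontr)
  define R where "R = sqrt (inverse l * \<epsilon>)"
  assume "\<not> ?thesis"
  then have r: "R + \<delta> / l < r" by (simp add: R_def)
  have R: "0 \<le> R" "l * R\<^sup>2 = \<epsilon>"
    using assms by (auto simp: R_def)
  have "0 \<le> \<delta> / l"
    using \<open>0 < l\<close> \<open>0 \<le> \<delta>\<close> by simp
  then have "R \<le> r" "0 < r"
    using r R(1) by linarith+
  then have "l * R\<^sup>2 \<le> l * (R * r)"
    using R(1) \<open>0 < l\<close> by (simp add: power2_eq_square mult_left_mono)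
  also have "l * (R * r) < l * ((r - \<delta> / l) * r)"
    using r \<open>0 < r\<close> \<open>0 < l\<close> by simp
  also have "\<dots> = l * r\<^sup>2 - \<delta> * r"
    using \<open>0 < l\<close> by (simp add: power2_eq_square field_simps)
  finally show False
    using assms(4) R(2) by simp
qed

text \<open>
  Ekeland's principle provides the base point, the Separation Principle the subgradient, and
  membership in the enlargement the inequality that controls the distance.
\<close>

proposition approximate_enlargement:
  fixes D :: "('a::banach \<Rightarrow> ereal) \<Rightarrow> 'a operator" and f :: "'a \<Rightarrow> ereal"
  assumes D: "subdifferential D" "separation_principle D"
    and f: "proper_lsc f" "prox_bounded f" and l: "prox_threshold f < l"
    and "0 \<le> \<epsilon>" and x: "(x, xs) \<in> enlargement (D f) \<epsilon>" and "0 < \<eta>"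
  obtains y ys where "(y, ys) \<in> D f"
    "norm (x - y) \<le> sqrt (inverse l * \<epsilon>) + \<eta>" "norm (xs - ys) \<le> sqrt (l * \<epsilon>) + \<eta>"
proof -
  have "0 < l"
    using prox_threshold_nonneg[OF f(2)] l by simp
  \<comment> \<open>The final errors are \<open>\<delta> / l\<close> in the space and \<open>2 * \<delta>\<close> in the dual.\<close>
  define \<delta> where "\<delta> = min (\<eta> / 2) (l * \<eta>)"
  have \<delta>: "0 < \<delta>" "2 * \<delta> \<le> \<eta>" "\<delta> / l \<le> \<eta>"
    using \<open>0 < \<eta>\<close> \<open>0 < l\<close> by (auto simp: \<delta>_def field_simps min_def)
  define q where "q y = l / 2 * (norm (y - x))\<^sup>2 - blinfun_apply xs y" for y
  define g where "g y = f y + ereal (q y)" for y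
  have q_cont: "continuous_on UNIV q"
    unfolding q_def by (intro continuous_intros)
  have dom_g: "dom g = dom f"
    by (auto simp: dom_def g_def)
  have g: "proper_lsc g"
    using f(1) lower_semicontinuous_add_continuous[OF _ q_cont, of f] dom_g
    by (simp add: proper_lsc_def proper_def g_def[abs_def])
  obtain c where "\<And>y. ereal c \<le> g y"
    using bounded_below_tilted_regularization[OF f(2) l, of x xs] unfolding g_def q_def by blast
  then obtain y where y: "y \<in> dom g" "\<And>z. g y \<le> g z + ereal (\<delta> * dist z y)"
    using ekeland_minimum[OF g _ \<delta>(1)] by blast
  define \<psi> where "\<psi> z = q z + \<delta> * norm (z - y)" for z
  have xs_convex: "convex_on UNIV (\<lambda>z. - blinfun_apply xs z)"
    by (intro convex_onI) (auto simp: blinfun.add_right blinfun.scaleR_right)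
  have norm_convex: "convex_on UNIV (\<lambda>z. norm (z - y))"
    using convex_on_dist[OF convex_UNIV, of y] by (simp add: dist_norm norm_minus_commute)
  have \<psi>_eq: "\<psi> = (\<lambda>z. (l / 2 * (norm (z - x))\<^sup>2 + - blinfun_apply xs z) + \<delta> * norm (z - y))"
    by (simp add: fun_eq_iff \<psi>_def q_def)
  have \<psi>_convex: "convex_on UNIV \<psi>"
    unfolding \<psi>_eq using \<open>0 < l\<close> \<delta>(1)
    by (intro convex_on_add convex_on_cmul convex_on_norm_diff_power2 xs_convex norm_convex) auto
  have \<psi>_cont: "continuous_on UNIV \<psi>"
    unfolding \<psi>_def by (intro continuous_intros q_cont)
  have "(norm xs)-lipschitz_on (ball y 1) (blinfun_apply xs)"
    by (rule lipschitz_onI)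
       (auto simp: dist_norm norm_blinfun simp flip: blinfun.diff_right real_norm_def)
  moreover have "1-lipschitz_on (ball y 1) (\<lambda>z. norm (z - y))"
    by (rule lipschitz_onI) (use norm_triangle_ineq3[of "_ - y" "_ - y"] in \<open>auto simp: dist_norm\<close>)
  ultimately obtain L where \<psi>_lipschitz: "L-lipschitz_on (ball y 1) \<psi>"
    unfolding \<psi>_def q_def
    using lipschitz_on_ball_norm_diff_power2[of y x]
    by (metis (no_types) lipschitz_on_add lipschitz_on_diff lipschitz_on_cmult_real)
  have "f y + ereal (\<psi> y) \<le> f z + ereal (\<psi> z)" for z
    using y(2)[of z] unfolding g_def \<psi>_def
    by (simp add: dist_norm add.assoc flip: plus_ereal.simps)
  then obtain ys where ys: "(y, ys) \<in> D f" "\<And>z. \<psi> y - blinfun_apply ys (z - y) \<le> \<psi> z"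
    using separation_real_perturbation[OF D f(1) _ \<psi>_convex \<psi>_cont open_ball _ \<psi>_lipschitz] y(1) dom_g
    by (metis centre_in_ball zero_less_one)
  define s where "s = xs - ys"
  have "l / 2 * (norm (y - x))\<^sup>2 + blinfun_apply s (z - y)
          \<le> l / 2 * (norm (z - x))\<^sup>2 + \<delta> * norm (z - y)" for z
    using ys(2)[of z]
    by (simp add: \<psi>_def q_def s_def blinfun.diff_left blinfun.diff_right algebra_simps)
  then have s: "norm s \<le> l * norm (y - x) + \<delta>"
      "l * (norm (y - x))\<^sup>2 - \<delta> * norm (y - x) \<le> blinfun_apply s (y - x)"
    using \<open>0 < l\<close> \<delta>(1) by (auto intro!: penalty_subgradient_estimates)
  have "- \<epsilon> \<le> blinfun_apply (ys - xs) (y - x)"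
    using x ys(1) by (auto simp: enlargement_def)
  then have "blinfun_apply s (y - x) \<le> \<epsilon>"
    by (simp add: s_def blinfun.diff_left)
  with s(2) have r: "norm (y - x) \<le> sqrt (inverse l * \<epsilon>) + \<delta> / l"
    using \<open>0 < l\<close> \<delta>(1) \<open>0 \<le> \<epsilon>\<close> by (intro sqrt_bound_of_quadratic) auto
  have "l * norm (y - x) \<le> l * (sqrt (inverse l * \<epsilon>) + \<delta> / l)"
    using r \<open>0 < l\<close> by (intro mult_left_mono) auto
  also have "\<dots> = l * sqrt (inverse l * \<epsilon>) + \<delta>"
    using \<open>0 < l\<close> by (simp add: field_simps)
  also have "l * sqrt (inverse l * \<epsilon>) = sqrt (l * \<epsilon>)"
  proof -
    have "l * sqrt (inverse l * \<epsilon>) = sqrt (l\<^sup>2 * (inverse l * \<epsilon>))"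
      using \<open>0 < l\<close> by (simp only: real_sqrt_mult) simp
    also have "l\<^sup>2 * (inverse l * \<epsilon>) = l * \<epsilon>"
      using \<open>0 < l\<close> by (simp add: power2_eq_square)
    finally show ?thesis .
  qed
  finally have "norm s \<le> sqrt (l * \<epsilon>) + \<eta>"
    using s(1) \<delta>(2) by simp
  then show thesis
    using that[OF ys(1)] r \<delta>(3) by (simp add: s_def norm_minus_commute)
qed

section \<open>From approximations to closures and sequences\<close>

text \<open>
  Project \<open>w\<close> radially onto the ball of radius \<open>R\<close>, which may be \<open>{0}\<close>.
\<close>

lemma cball_approximation:
  fixes w :: "'a::real_normed_vector"
  assumes "norm w \<le> R + \<eta>" "0 \<le> R" "0 \<le> \<eta>"
  obtains a where "a \<in> (*\<^sub>R) R ` unit_ball" "norm (w - a) \<le> \<eta>"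
proof (cases "norm w \<le> R")
  case True
  have "w = R *\<^sub>R (w /\<^sub>R R)" "norm (w /\<^sub>R R) \<le> 1"
    using True \<open>0 \<le> R\<close> by (cases "R = 0"; simp add: field_simps)+
  then show thesis
    using that[of w] \<open>0 \<le> \<eta>\<close> by (metis diff_self imageI mem_cball_0 norm_zero)
next
  case False
  then have "0 < norm w" using \<open>0 \<le> R\<close> by linarith
  let ?a = "R *\<^sub>R (w /\<^sub>R norm w)"
  have "w - ?a = (1 - R / norm w) *\<^sub>R w"
    by (simp add: algebra_simps divide_inverse)
  also have "norm \<dots> = norm w - R"
    using False \<open>0 \<le> R\<close> \<open>0 < norm w\<close> by (simp add: field_simps)
  finally have "norm (w - ?a) = norm w - R" .
  moreover have "?a \<in> (*\<^sub>R) R ` unit_ball"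
    using \<open>0 < norm w\<close> by (intro imageI) simp
  ultimately show thesis
    using that assms(1) by simp
qed

lemma closure_plus_balls_if_approximable:
  fixes x :: "'a::real_normed_vector" and xs :: "'b::real_normed_vector"
  assumes approx: "\<And>\<eta>. 0 < \<eta> \<Longrightarrow> \<exists>(y, ys)\<in>A. norm (x - y) \<le> R + \<eta> \<and> norm (xs - ys) \<le> Q + \<eta>"
    and "0 \<le> R" "0 \<le> Q"
  shows "(x, xs) \<in> closure (A + ((*\<^sub>R) R ` unit_ball) \<times> ((*\<^sub>R) Q ` unit_ball))"
  unfolding closure_approachable
proof (intro allI impI)
  fix e :: real assume "0 < e"
  then obtain y ys where y: "(y, ys) \<in> A" "norm (x - y) \<le> R + e / 3" "norm (xs - ys) \<le> Q + e / 3"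
    using approx[of "e / 3"] by auto
  obtain a where a: "a \<in> (*\<^sub>R) R ` unit_ball" "norm (x - y - a) \<le> e / 3"
    using cball_approximation[OF y(2)] \<open>0 \<le> R\<close> \<open>0 < e\<close> by auto
  obtain b where b: "b \<in> (*\<^sub>R) Q ` unit_ball" "norm (xs - ys - b) \<le> e / 3"
    using cball_approximation[OF y(3)] \<open>0 \<le> Q\<close> \<open>0 < e\<close> by auto
  have "dist ((y, ys) + (a, b)) (x, xs) = norm (x - y - a, xs - ys - b)"
    by (subst dist_commute) (simp add: dist_norm diff_diff_eq)
  also have "\<dots> \<le> norm (x - y - a) + norm (xs - ys - b)"
    by (rule norm_Pair_le)
  finally have "dist ((y, ys) + (a, b)) (x, xs) < e"
    using a(2) b(2) \<open>0 < e\<close> by simp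
  then show "\<exists>z\<in>A + ((*\<^sub>R) R ` unit_ball) \<times> ((*\<^sub>R) Q ` unit_ball). dist z (x, xs) < e"
    using y(1) a(1) b(1) by (intro bexI[of _ "(y, ys) + (a, b)"] set_plus_intro) auto
qed

lemma convergent_norms_if_approximable:
  fixes x :: "'a::real_normed_vector" and xs :: "'b::real_normed_vector"
  assumes approx: "\<And>\<eta>. 0 < \<eta> \<Longrightarrow> \<exists>(y, ys)\<in>A. norm (x - y) \<le> R + \<eta> \<and> norm (xs - ys) \<le> Q + \<eta>"
  shows "\<exists>u us. (\<forall>n. (u n, us n) \<in> A) \<and>
           convergent (\<lambda>n. norm (x - u n)) \<and> lim (\<lambda>n. norm (x - u n)) \<le> R \<and>
           convergent (\<lambda>n. norm (xs - us n)) \<and> lim (\<lambda>n. norm (xs - us n)) \<le> Q"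
proof -
  have "\<exists>p. \<forall>n. p n \<in> A \<and> norm (x - fst (p n)) \<le> R + inverse (Suc n)
          \<and> norm (xs - snd (p n)) \<le> Q + inverse (Suc n)"
    using approx[of "inverse (Suc _)"] by (intro choice allI) fastforce
  then obtain p where p: "\<And>n. p n \<in> A" "\<And>n. norm (x - fst (p n)) \<le> R + inverse (Suc n)"
      "\<And>n. norm (xs - snd (p n)) \<le> Q + inverse (Suc n)"
    by blast
  \<comment> \<open>Pairing the two distances lets one subsequence serve both.\<close>
  define v where "v n = (norm (x - fst (p n)), norm (xs - snd (p n)))" for n
  have "inverse (Suc n) \<le> (1::real)" for n
    by (simp add: field_simps)
  then have "v n \<in> {0..R + 1} \<times> {0..Q + 1}" for n
    using p(2,3)[of n] by (auto simp: v_def intro: order_trans)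
  then obtain k \<sigma> where \<sigma>: "strict_mono \<sigma>" "(v \<circ> \<sigma>) \<longlonglongrightarrow> k"
    using seq_compactE[of "{0..R + 1} \<times> {0..Q + 1}" v] compact_Times[of "{0..R + 1}" "{0..Q + 1}"]
    by (metis compact_Icc compact_eq_seq_compact_metric)
  have lim1: "(\<lambda>n. norm (x - fst (p (\<sigma> n)))) \<longlonglongrightarrow> fst k"
    using tendsto_fst[OF \<sigma>(2)] by (simp add: v_def comp_def)
  have lim2: "(\<lambda>n. norm (xs - snd (p (\<sigma> n)))) \<longlonglongrightarrow> snd k"
    using tendsto_snd[OF \<sigma>(2)] by (simp add: v_def comp_def)
  have null: "(\<lambda>n. C + inverse (Suc (\<sigma> n))) \<longlonglongrightarrow> C" for C :: real
    using LIMSEQ_subseq_LIMSEQ[OF LIMSEQ_inverse_real_of_nat_add[of C] \<sigma>(1)]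
    by (simp add: comp_def)
  have "fst k \<le> R"
    using p(2) by (intro LIMSEQ_le[OF lim1 null]) auto
  moreover have "snd k \<le> Q"
    using p(3) by (intro LIMSEQ_le[OF lim2 null]) auto
  ultimately show ?thesis
    using p(1) lim1 lim2
    by (intro exI[of _ "\<lambda>n. fst (p (\<sigma> n))"] exI[of _ "\<lambda>n. snd (p (\<sigma> n))"])
       (auto simp: limI convergent_def)
qed

theorem theorem2p4:
  fixes D :: "('a::banach \<Rightarrow> ereal) \<Rightarrow> 'a operator"
    and f :: "'a \<Rightarrow> ereal"
    and l \<epsilon> :: real
  assumes "subdifferential D"
    and "separation_principle D"
    and "proper_lsc f"
    and "prox_bounded f"
    and "l > prox_threshold f"
    and "\<epsilon> \<ge> 0"
  shows "enlargement (D f) \<epsilon> \<subseteq>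
           closure (D f + ((*\<^sub>R) (sqrt (inverse l * \<epsilon>)) ` unit_ball) \<times>
                          ((*\<^sub>R) (sqrt (l * \<epsilon>)) ` unit_ball)) \<and>
         (\<forall>(x, xs)\<in>enlargement (D f) \<epsilon>.
            \<exists>u us. (\<forall>n. (u n, us n) \<in> D f) \<and>
              convergent (\<lambda>n. norm (x - u n)) \<and>
              lim (\<lambda>n. norm (x - u n)) \<le> sqrt (inverse l * \<epsilon>) \<and>
              convergent (\<lambda>n. norm (xs - us n)) \<and>
              lim (\<lambda>n. norm (xs - us n)) \<le> sqrt (l * \<epsilon>))"
proof -
  have nonneg: "0 \<le> sqrt (inverse l * \<epsilon>)" "0 \<le> sqrt (l * \<epsilon>)"
    using prox_threshold_nonneg[OF assms(4)] assms(5,6) by auto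
  have approx: "\<exists>(y, ys)\<in>D f. norm (x - y) \<le> sqrt (inverse l * \<epsilon>) + \<eta> \<and>
                              norm (xs - ys) \<le> sqrt (l * \<epsilon>) + \<eta>"
    if "(x, xs) \<in> enlargement (D f) \<epsilon>" "0 < \<eta>" for x xs \<eta>
    using approximate_enlargement[OF assms that] by blast
  show ?thesis
    using closure_plus_balls_if_approximable[OF approx nonneg]
      convergent_norms_if_approximable[OF approx]
    by auto
qed

end
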